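(* For every integer $n\geq 1$, $2n-4\leq \mathrm{ex}_{\mathcal{P}}(n,S_{2,3})\leq 2n$.
   Context: All graphs are finite and simple. For a graph $F$, the planar Turán number $\mathrm{ex}_{\mathcal{P}}(n,F)$ is the maximum number of edges in an $n$-vertex planar graph that contains no subgraph isomorphic to $F$. For positive integers $m,k$, the double star $S_{m,k}$ is the tree obtained from an edge $xy$ (the backbone) by joining $x$ to $m$ new vertices and $y$ to $k$ further new vertices, all these $m+k$ vertices distinct. *)

theory Defs
  imports "HOL-Analysis.Analysis"
begin

definition simple_graph :: "'a set \<Rightarrow> 'a set set \<Rightarrow> bool" where
  "simple_graph V E \<longleftrightarrow> finite V \<and> (\<forall>e\<in>E. e \<subseteq> V \<and> card e = 2)"

definition planar_graph :: "'a set \<Rightarrow> 'a set set \<Rightarrow> bool" where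
  "planar_graph V E \<longleftrightarrow>
     (\<exists>(p :: 'a \<Rightarrow> complex) (\<gamma> :: 'a set \<Rightarrow> real \<Rightarrow> complex).
        inj_on p V \<and>
        (\<forall>e\<in>E. arc (\<gamma> e) \<and>
                 {pathstart (\<gamma> e), pathfinish (\<gamma> e)} = p ` e \<and>
                 path_image (\<gamma> e) \<inter> p ` V = p ` e) \<and>
        (\<forall>e\<in>E. \<forall>e'\<in>E. e \<noteq> e' \<longrightarrow>
                 path_image (\<gamma> e) \<inter> path_image (\<gamma> e') \<subseteq> p ` (e \<inter> e')))"

definition contains_subgraph ::
  "'a set \<Rightarrow> 'a set set \<Rightarrow> 'b set \<Rightarrow> 'b set set \<Rightarrow> bool" where
  "contains_subgraph V E VF EF \<longleftrightarrow>
     (\<exists>\<phi>. inj_on \<phi> VF \<and> \<phi> ` VF \<subseteq> V \<and> (\<forall>e\<in>EF. \<phi> ` e \<in> E))"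

text \<open>Planar Turan number: max number of edges of an n-vertex planar graph with no
  subgraph isomorphic to F = (VF,EF).  Vertices are taken from nat, which loses no
  generality (every n-vertex graph is isomorphic to one on natural numbers).\<close>
definition exP :: "nat \<Rightarrow> 'b set \<Rightarrow> 'b set set \<Rightarrow> nat" where
  "exP n VF EF = Max {card E | (V :: nat set) E.
       card V = n \<and> simple_graph V E \<and> planar_graph V E \<and> \<not> contains_subgraph V E VF EF}"

definition dstar_V :: "nat \<Rightarrow> nat \<Rightarrow> nat set" where
  "dstar_V m k = {..<m+k+2}"

definition dstar_E :: "nat \<Rightarrow> nat \<Rightarrow> nat set set" where
  "dstar_E m k = {{0,1}} \<union> {{0,i} | i. 2 \<le> i \<and> i \<le> m+1}
                 \<union> {{1,i} | i. m+2 \<le> i \<and> i \<le> m+k+1}"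

end

theory Submission
  imports Defs
begin

text \<open>Upper bound, by induction on the number of vertices. A vertex of degree at most 2 can be
  deleted, and if all degrees are at most 4 the bound is the handshake identity. Otherwise all
  degrees are at least 3 and some \<open>y\<close> has degree at least 5; a neighbour of \<open>y\<close> with a neighbour
  outside the closed neighbourhood of \<open>y\<close> would give an \<open>S\<^sub>2\<^sub>,\<^sub>3\<close>, as would degree above 5, so that
  closed neighbourhood is a component with 6 vertices. A graph with 6 vertices and 13
  edges contains \<open>K\<^sub>3\<^sub>,\<^sub>3\<close>, so the component has at most 12 edges. That \<open>K\<^sub>3\<^sub>,\<^sub>3\<close> is not planar follows from
  the theta-curve form of the Jordan curve theorem: each face of a theta curve touches only two of its
  three arcs. The lower bound is witnessed by \<open>K\<^sub>2\<^sub>,\<^sub>n\<^sub>-\<^sub>2\<close>, drawn with the two centres on the real axis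
  and the other vertices on the imaginary axis.\<close>

section \<open>Theta curves and the Jordan curve theorem\<close>

lemma inside_iff_if_connected:
  assumes "connected S" "S \<inter> J = {}" "x \<in> S" "y \<in> S"
  shows "x \<in> inside J \<longleftrightarrow> y \<in> inside J"
proof -
  have "connected_component (- J) x y"
    using assms unfolding connected_component_def by blast
  then show ?thesis
    using connected_component_sym inside_same_component by metis
qed

text \<open>The third arc cuts the inside of the cycle of the first two into the insides of the two
  other cycles. The leg \<open>T3\<close> puts \<open>z\<close> inside the large cycle, hence in one
  of the two pieces. The leg to the arc that does not bound that piece carries its endpoint,
  \<open>a1\<close> or \<open>a2\<close>, into the piece as well, although this point lies on the
  large cycle.\<close>

lemma theta_inside_contradiction:
  fixes c1 c2 c3 :: "real \<Rightarrow> complex"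
  assumes arcs: "arc c1" "arc c2" "arc c3"
    and starts: "pathstart c1 = u" "pathstart c2 = u" "pathstart c3 = u"
    and ends: "pathfinish c1 = v" "pathfinish c2 = v" "pathfinish c3 = v"
    and ints: "path_image c1 \<inter> path_image c2 = {u,v}" "path_image c1 \<inter> path_image c3 = {u,v}"
      "path_image c2 \<inter> path_image c3 = {u,v}"
    and on: "a1 \<in> path_image c1 - {u,v}" "a2 \<in> path_image c2 - {u,v}" "a3 \<in> path_image c3 - {u,v}"
    and conn: "connected (insert a1 T1)" "connected (insert a2 T2)" "connected (insert a3 T3)"
    and z: "z \<in> T1" "z \<in> T2" "z \<in> T3"
    and disj: "(T1 \<union> T2 \<union> T3) \<inter> (path_image c1 \<union> path_image c2 \<union> path_image c3) = {}"
    and meets: "path_image c3 \<inter> inside (path_image c1 \<union> path_image c2) \<noteq> {}"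
  shows False
proof -
  let ?P1 = "path_image c1" and ?P2 = "path_image c2" and ?P3 = "path_image c3"
  have "u \<noteq> v" using arcs(1) starts(1) ends(1) arc_distinct_ends by metis
  then have eq: "inside (?P1 \<union> ?P3) \<union> inside (?P2 \<union> ?P3) \<union> (?P3 - {u,v}) = inside (?P1 \<union> ?P2)"
    using split_inside_simple_closed_curve[of c1 u v c2 c3] assms arc_imp_simple_path by metis
  have z3: "z \<in> inside (?P1 \<union> ?P2) \<longleftrightarrow> a3 \<in> inside (?P1 \<union> ?P2)"
    by (rule inside_iff_if_connected[OF conn(3)]) (use z disj on ints in blast)+
  have z2: "z \<in> inside (?P1 \<union> ?P3) \<longleftrightarrow> a2 \<in> inside (?P1 \<union> ?P3)"
    by (rule inside_iff_if_connected[OF conn(2)]) (use z disj on ints in blast)+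
  have z1: "z \<in> inside (?P2 \<union> ?P3) \<longleftrightarrow> a1 \<in> inside (?P2 \<union> ?P3)"
    by (rule inside_iff_if_connected[OF conn(1)]) (use z disj on ints in blast)+
  have "a1 \<notin> inside (?P1 \<union> ?P2)" "a2 \<notin> inside (?P1 \<union> ?P2)"
    using on inside_no_overlap by blast+
  moreover have "z \<in> inside (?P1 \<union> ?P2)" "z \<notin> ?P3"
    using z3 eq on z disj by blast+
  ultimately show False using z1 z2 eq by blast
qed

text \<open>Inversion about \<open>p\<close> exchanges \<open>p\<close> and infinity. If the image
  of \<open>q\<close> were outside the image of \<open>J\<close>, it could be joined off that image
  to points of arbitrarily large modulus. Undoing the inversion would join \<open>q\<close> to
  points near \<open>p\<close> while avoiding \<open>J\<close>, so \<open>q\<close> would be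
  inside.\<close>

lemma inversion_outside_to_inside:
  fixes J :: "complex set"
  assumes "compact J" "p \<in> inside J" "q \<in> outside J"
  shows "inverse (q - p) \<in> inside ((\<lambda>x. inverse (x - p)) ` J)"
proof (rule ccontr)
  let ?f = "\<lambda>x. inverse (x - p)" and ?g = "\<lambda>w. p + inverse w"
  assume neg: "?f q \<notin> inside (?f ` J)"
  have "p \<notin> J" "q \<notin> J" "q \<noteq> p"
    using assms(2,3) by (auto simp: inside_def outside_def)
  have "compact (?f ` J)"
    using \<open>p \<notin> J\<close> assms(1) by (force intro!: compact_continuous_image continuous_on_inverse continuous_on_diff)
  have "?f q \<notin> ?f ` J"
    using \<open>q \<notin> J\<close> by auto
  with neg have "?f q \<in> outside (?f ` J)"
    by (simp add: inside_outside)
  \<comment> \<open>The point 0 corresponds to infinity, so it is removed before pulling back; an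
    open connected set in the plane stays connected without one point.\<close>
  let ?O = "outside (?f ` J) - {0}"
  have "open (outside (?f ` J))" "connected (outside (?f ` J))"
    using \<open>compact (?f ` J)\<close>
    by (auto intro!: open_outside connected_outside compact_imp_closed compact_imp_bounded)
  then have "connected ?O"
    by (intro connected_open_delete) auto
  then have "connected (?g ` ?O)"
    by (rule connected_continuous_image[rotated]) (auto intro!: continuous_on_inverse continuous_on_add)
  moreover have "?g ` ?O \<inter> J = {}"
  proof -
    have "w \<in> ?f ` J" if "?g w \<in> J" "w \<noteq> 0" for w
      using that by (intro image_eqI[of _ _ "?g w"]) auto
    then show ?thesis by (fastforce simp: outside_def)
  qed
  moreover have "q \<in> ?g ` ?O"
    using \<open>?f q \<in> outside _\<close> \<open>q \<noteq> p\<close> by (intro image_eqI[of _ _ "?f q"]) auto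
  \<comment> \<open>A point of modulus above \<open>1 / e\<close> is pulled back into the ball of
    radius \<open>e\<close> about \<open>p\<close>, hence inside \<open>J\<close>.\<close>
  moreover obtain w where "w \<in> ?O" "?g w \<in> inside J"
  proof -
    obtain e where e: "e > 0" "ball p e \<subseteq> inside J"
      using open_inside[of J] compact_imp_closed[OF assms(1)] assms(2) open_contains_ball by blast
    have "\<not> bounded (outside (?f ` J))"
      using \<open>compact (?f ` J)\<close> compact_imp_bounded unbounded_outside by blast
    then obtain w where w: "w \<in> outside (?f ` J)" "norm w > 1 / e"
      unfolding bounded_iff by (meson not_le)
    have "norm w > 0" using w(2) e(1) by (smt (verit) divide_pos_pos)
    then have "norm (inverse w) < e"
      using w(2) e(1) unfolding norm_inverse by (simp add: field_simps)
    then have "?g w \<in> ball p e" by (simp add: dist_norm)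
    then show ?thesis using that w e \<open>norm w > 0\<close> by auto
  qed
  ultimately have "q \<in> inside J"
    using inside_iff_if_connected[of "?g ` ?O" J "?g w" q] by blast
  then show False using assms(3) by (simp add: inside_def outside_def)
qed

text \<open>If the third arc runs outside the cycle formed by the other two, an inversion
  centred inside that cycle moves it to the inside.\<close>

lemma theta_contradiction:
  fixes c1 c2 c3 :: "real \<Rightarrow> complex"
  assumes arcs: "arc c1" "arc c2" "arc c3"
    and starts: "pathstart c1 = u" "pathstart c2 = u" "pathstart c3 = u"
    and ends: "pathfinish c1 = v" "pathfinish c2 = v" "pathfinish c3 = v"
    and ints: "path_image c1 \<inter> path_image c2 = {u,v}" "path_image c1 \<inter> path_image c3 = {u,v}"
      "path_image c2 \<inter> path_image c3 = {u,v}"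
    and on: "a1 \<in> path_image c1 - {u,v}" "a2 \<in> path_image c2 - {u,v}" "a3 \<in> path_image c3 - {u,v}"
    and conn: "connected T1" "connected T2" "connected T3"
    and conn': "connected (insert a1 T1)" "connected (insert a2 T2)" "connected (insert a3 T3)"
    and z: "z \<in> T1" "z \<in> T2" "z \<in> T3"
    and disj: "(T1 \<union> T2 \<union> T3) \<inter> (path_image c1 \<union> path_image c2 \<union> path_image c3) = {}"
  shows False
proof (cases "path_image c3 \<inter> inside (path_image c1 \<union> path_image c2) = {}")
  case False
  then show ?thesis using theta_inside_contradiction[of c1 c2 c3 u v a1 a2 a3 T1 T2 T3 z] assms by blast
next
  case True
  let ?J = "path_image c1 \<union> path_image c2"
  have "u \<noteq> v" using arcs(1) starts(1) ends(1) arc_distinct_ends by metis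
  \<comment> \<open>By the Jordan curve theorem the cycle has a nonempty inside, which supplies the
    centre \<open>p\<close> of the inversion.\<close>
  have "simple_path (c1 +++ reversepath c2)"
    using arcs starts ends ints by (simp add: simple_path_join_loop_eq arc_reversepath)
  then have "inside (path_image (c1 +++ reversepath c2)) \<noteq> {}"
    using Jordan_inside_outside[of "c1 +++ reversepath c2"] starts by simp
  then obtain p where p: "p \<in> inside ?J"
    using ends by (auto simp: path_image_join)
  have pP: "p \<notin> ?J" "p \<notin> path_image c3"
    using p True inside_no_overlap by blast+
  have a3: "a3 \<in> outside ?J" "a3 \<notin> inside ?J"
    using True on ints by (auto simp: outside_inside)
  \<comment> \<open>The inversion must be continuous on the legs too. They all contain
    \<open>z\<close>, which \<open>T3\<close> links to the outside point \<open>a3\<close>, so none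
    of them reaches \<open>p\<close>.\<close>
  have "z \<notin> inside ?J"
    using inside_iff_if_connected[OF conn'(3), of ?J z a3] a3 on ints z disj by blast
  then have pT: "p \<notin> T1" "p \<notin> T2" "p \<notin> T3"
    using inside_iff_if_connected[of _ ?J z p] conn z disj p by blast+
  define f where "f x = inverse (x - p)" for x :: complex
  have inj: "inj f" unfolding f_def by (simp add: inj_def)
  have cont: "continuous_on S f" if "p \<notin> S" for S
    unfolding f_def using that by (intro continuous_intros) auto
  have img: "path_image (f \<circ> c) = f ` path_image c" for c
    by (rule path_image_compose)
  have arc: "arc (f \<circ> c)" if "arc c" "p \<notin> path_image c" for c
    using that cont[of "path_image c"] inj
    by (auto simp: arc_def path_continuous_image intro: comp_inj_on inj_on_subset)
  have conn_f: "connected (f ` S)" if "connected S" "p \<notin> S" for S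
    using that cont connected_continuous_image by blast
  have p': "p \<notin> insert a1 T1" "p \<notin> insert a2 T2" "p \<notin> insert a3 T3"
    using pT pP on by auto
  have im_eq: "f ` A \<inter> f ` B = f ` (A \<inter> B)" for A B
    using image_Int[OF inj] by metis
  have "compact ?J" using arcs by (simp add: compact_arc_image compact_Un)
  have "f a3 \<in> inside (f ` ?J)"
    using inversion_outside_to_inside[OF \<open>compact ?J\<close> p a3(1)] unfolding f_def .
  then have meets: "path_image (f \<circ> c3) \<inter> inside (path_image (f \<circ> c1) \<union> path_image (f \<circ> c2)) \<noteq> {}"
    using on by (auto simp: img image_Un)
  show ?thesis
  proof (rule theta_inside_contradiction[OF _ _ _ _ _ _ _ _ _ _ _ _ _ _ _ _ _ _ _ _ _ _ meets])
    show "arc (f \<circ> c1)" "arc (f \<circ> c2)" "arc (f \<circ> c3)"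
      using arc arcs pP by auto
    show "pathstart (f \<circ> c1) = f u" "pathstart (f \<circ> c2) = f u" "pathstart (f \<circ> c3) = f u"
      "pathfinish (f \<circ> c1) = f v" "pathfinish (f \<circ> c2) = f v" "pathfinish (f \<circ> c3) = f v"
      using starts ends by (simp_all add: pathstart_compose pathfinish_compose)
    show "path_image (f \<circ> c1) \<inter> path_image (f \<circ> c2) = {f u, f v}"
      "path_image (f \<circ> c1) \<inter> path_image (f \<circ> c3) = {f u, f v}"
      "path_image (f \<circ> c2) \<inter> path_image (f \<circ> c3) = {f u, f v}"
      by (simp_all add: img im_eq ints)
    show "f a1 \<in> path_image (f \<circ> c1) - {f u, f v}" "f a2 \<in> path_image (f \<circ> c2) - {f u, f v}"
      "f a3 \<in> path_image (f \<circ> c3) - {f u, f v}"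
      using on inj by (auto simp: img inj_eq)
    show "connected (insert (f a1) (f ` T1))" "connected (insert (f a2) (f ` T2))"
      "connected (insert (f a3) (f ` T3))"
      using conn_f[OF conn'(1) p'(1)] conn_f[OF conn'(2) p'(2)] conn_f[OF conn'(3) p'(3)] by simp_all
    show "f z \<in> f ` T1" "f z \<in> f ` T2" "f z \<in> f ` T3" using z by auto
    show "(f ` T1 \<union> f ` T2 \<union> f ` T3) \<inter> (path_image (f \<circ> c1) \<union> path_image (f \<circ> c2) \<union> path_image (f \<circ> c3)) = {}"
      unfolding img image_Un[symmetric] im_eq disj by simp
  qed
qed

section \<open>Non-planarity of K_{3,3}\<close>

lemma connected_arc_image_delete_end:
  assumes "arc g"
  shows "connected (path_image g - {pathfinish g})"
proof -
  \<comment> \<open>By injectivity only the parameter 1 reaches the end.\<close>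
  have "path_image g - {pathfinish g} = g ` {0..<1}"
    using assms unfolding arc_def path_image_def pathfinish_def inj_on_def by (force simp: less_le)
  moreover have "connected (g ` {0..<1})"
    using assms by (intro connected_continuous_image)
      (auto simp: arc_def path_def intro: continuous_on_subset)
  ultimately show ?thesis by simp
qed

text \<open>In \<open>planar_graph\<close> the arc of an edge has no prescribed direction. Reversing
  it where necessary gives arcs indexed by ordered pairs, which can be concatenated into
  paths.\<close>

lemma planar_graph_oriented_arcs:
  fixes V :: "'a set"
  assumes "planar_graph V E"
  obtains p :: "'a \<Rightarrow> complex" and g where "inj_on p V"
    and "\<And>x y. {x,y} \<in> E \<Longrightarrow> arc (g x y) \<and> pathstart (g x y) = p x \<and> pathfinish (g x y) = p y
           \<and> path_image (g x y) \<inter> p ` V = {p x, p y}"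
    and "\<And>x y x' y'. {x,y} \<in> E \<Longrightarrow> {x',y'} \<in> E \<Longrightarrow> {x,y} \<noteq> {x',y'} \<Longrightarrow>
           path_image (g x y) \<inter> path_image (g x' y') \<subseteq> p ` ({x,y} \<inter> {x',y'})"
proof -
  obtain p :: "'a \<Rightarrow> complex" and \<gamma> where inj: "inj_on p V"
    and arc: "\<forall>e\<in>E. arc (\<gamma> e) \<and> {pathstart (\<gamma> e), pathfinish (\<gamma> e)} = p ` e \<and>
                 path_image (\<gamma> e) \<inter> p ` V = p ` e"
    and ints: "\<forall>e\<in>E. \<forall>e'\<in>E. e \<noteq> e' \<longrightarrow> path_image (\<gamma> e) \<inter> path_image (\<gamma> e') \<subseteq> p ` (e \<inter> e')"
    using assms unfolding planar_graph_def by (elim exE conjE)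
  define g where "g x y = (if pathstart (\<gamma> {x,y}) = p x then \<gamma> {x,y} else reversepath (\<gamma> {x,y}))" for x y
  have img: "path_image (g x y) = path_image (\<gamma> {x,y})" for x y
    by (simp add: g_def)
  show ?thesis
  proof (rule that[OF inj])
    fix x y assume e: "{x,y} \<in> E"
    have "{pathstart (\<gamma> {x,y}), pathfinish (\<gamma> {x,y})} = {p x, p y}" "arc (\<gamma> {x,y})"
      using bspec[OF arc e] by auto
    then show "arc (g x y) \<and> pathstart (g x y) = p x \<and> pathfinish (g x y) = p y
           \<and> path_image (g x y) \<inter> p ` V = {p x, p y}"
      using bspec[OF arc e] unfolding img by (auto simp: g_def doubleton_eq_iff arc_reversepath)
  next
    fix x y x' y' assume "{x,y} \<in> E" "{x',y'} \<in> E" "{x,y} \<noteq> {x',y'}"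
    then show "path_image (g x y) \<inter> path_image (g x' y') \<subseteq> p ` ({x,y} \<inter> {x',y'})"
      unfolding img using ints by simp
  qed
qed

text \<open>The paths from \<open>b1\<close> to \<open>b2\<close> through the three vertices of
  \<open>A\<close> form a theta curve, and \<open>b3\<close> is a point off it that is joined to an
  interior point of each of its three arcs.\<close>

lemma not_planar_K33:
  fixes V :: "'a set"
  assumes "planar_graph V E" and V: "A \<subseteq> V" "B \<subseteq> V" and "card A = 3" "card B = 3" "A \<inter> B = {}"
    and E: "\<And>a b. a \<in> A \<Longrightarrow> b \<in> B \<Longrightarrow> {a,b} \<in> E"
  shows False
proof -
  obtain a1 a2 a3 where A: "A = {a1,a2,a3}" "a1 \<noteq> a2" "a1 \<noteq> a3" "a2 \<noteq> a3"
    using \<open>card A = 3\<close> by (auto simp: card_3_iff)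
  obtain b1 b2 b3 where B: "B = {b1,b2,b3}" "b1 \<noteq> b2" "b1 \<noteq> b3" "b2 \<noteq> b3"
    using \<open>card B = 3\<close> by (auto simp: card_3_iff)
  obtain p :: "'a \<Rightarrow> complex" and g where inj: "inj_on p V"
    and arc: "\<And>x y. {x,y} \<in> E \<Longrightarrow> arc (g x y) \<and> pathstart (g x y) = p x \<and> pathfinish (g x y) = p y
           \<and> path_image (g x y) \<inter> p ` V = {p x, p y}"
    and ints: "\<And>x y x' y'. {x,y} \<in> E \<Longrightarrow> {x',y'} \<in> E \<Longrightarrow> {x,y} \<noteq> {x',y'} \<Longrightarrow>
           path_image (g x y) \<inter> path_image (g x' y') \<subseteq> p ` ({x,y} \<inter> {x',y'})"
    using planar_graph_oriented_arcs[OF assms(1)] by blast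
  have E': "{b,a} \<in> E" if "a \<in> A" "b \<in> B" for a b
    using E[OF that] by (simp add: insert_commute)
  have ne: "a \<noteq> b" if "a \<in> A" "b \<in> B" for a b
    using that \<open>A \<inter> B = {}\<close> by blast
  have p_eq: "p x = p y \<longleftrightarrow> x = y" if "x \<in> A \<union> B" "y \<in> A \<union> B" for x y
    using that inj V by (meson inj_on_eq_iff subsetD Un_least)
  \<comment> \<open>\<open>c a\<close> is the arc of the theta curve through \<open>a\<close>. The
    leg \<open>T a\<close> omits its end at \<open>a\<close>, so that it avoids the whole
    curve.\<close>
  define c where "c a = g b1 a +++ g a b2" for a
  define T where "T a = path_image (g b3 a) - {p a}" for a
  have arcs: "arc (g b a)" "pathstart (g b a) = p b" "pathfinish (g b a) = p a"
    "arc (g a b)" "pathstart (g a b) = p a" "pathfinish (g a b) = p b"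
    "p a \<in> path_image (g b a)" "p a \<in> path_image (g a b)" "p b \<in> path_image (g b a)" "p b \<in> path_image (g a b)"
    if "a \<in> A" "b \<in> B" for a b
    using arc[OF E[OF that]] arc[OF E'[OF that]] by blast+
  have bmem: "b1 \<in> B" "b2 \<in> B" "b3 \<in> B" using B by auto
  have amem: "a1 \<in> A" "a2 \<in> A" "a3 \<in> A" using A by auto
  have c_img: "path_image (c a) = path_image (g b1 a) \<union> path_image (g a b2)" if "a \<in> A" for a
    unfolding c_def using arcs that bmem by (simp add: path_image_join)
  have c_arc: "arc (c a)" if "a \<in> A" for a
    unfolding c_def
  proof (rule arc_join)
    have "path_image (g b1 a) \<inter> path_image (g a b2) \<subseteq> p ` ({b1,a} \<inter> {a,b2})"
      using that bmem B ne by (intro ints E E') (auto simp: doubleton_eq_iff)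
    also have "\<dots> \<subseteq> {p a}"
      using B ne[OF that] bmem by auto
    finally show "path_image (g b1 a) \<inter> path_image (g a b2) \<subseteq> {pathstart (g a b2)}"
      using arcs[OF that bmem(2)] by simp
  qed (use arcs that bmem in auto)
  have c_ends: "pathstart (c a) = p b1" "pathfinish (c a) = p b2" if "a \<in> A" for a
    unfolding c_def using arcs that bmem by simp_all
  have c_int: "path_image (c a) \<inter> path_image (c a') = {p b1, p b2}" if "a \<in> A" "a' \<in> A" "a \<noteq> a'" for a a'
  proof
    have "path_image (g b1 a) \<inter> path_image (g b1 a') \<subseteq> p ` ({b1,a} \<inter> {b1,a'})"
      "path_image (g b1 a) \<inter> path_image (g a' b2) \<subseteq> p ` ({b1,a} \<inter> {a',b2})"
      "path_image (g a b2) \<inter> path_image (g b1 a') \<subseteq> p ` ({a,b2} \<inter> {b1,a'})"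
      "path_image (g a b2) \<inter> path_image (g a' b2) \<subseteq> p ` ({a,b2} \<inter> {a',b2})"
      using that bmem B ne by (intro ints E E'; auto simp: doubleton_eq_iff)+
    moreover have "{b1,a} \<inter> {b1,a'} = {b1}" "{b1,a} \<inter> {a',b2} = {}" "{a,b2} \<inter> {b1,a'} = {}"
      "{a,b2} \<inter> {a',b2} = {b2}"
      using that B bmem ne by auto
    ultimately show "path_image (c a) \<inter> path_image (c a') \<subseteq> {p b1, p b2}"
      unfolding c_img[OF that(1)] c_img[OF that(2)] by auto
    show "{p b1, p b2} \<subseteq> path_image (c a) \<inter> path_image (c a')"
      unfolding c_img[OF that(1)] c_img[OF that(2)]
      using arcs[OF that(1) bmem(1)] arcs[OF that(1) bmem(2)] arcs[OF that(2) bmem(1)] arcs[OF that(2) bmem(2)]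
      by blast
  qed
  have T_disj: "T a \<inter> path_image (c a') = {}" if "a \<in> A" "a' \<in> A" for a a'
  proof -
    have "path_image (g b3 a) \<inter> path_image (g b1 a') \<subseteq> p ` ({b3,a} \<inter> {b1,a'})"
      "path_image (g b3 a) \<inter> path_image (g a' b2) \<subseteq> p ` ({b3,a} \<inter> {a',b2})"
      using that bmem B ne by (intro ints E E'; auto simp: doubleton_eq_iff)+
    moreover have "{b3,a} \<inter> {b1,a'} \<subseteq> {a}" "{b3,a} \<inter> {a',b2} \<subseteq> {a}"
      using that B bmem ne by auto
    ultimately show ?thesis
      unfolding c_img[OF that(2)] T_def by blast
  qed
  have T_conn: "connected (T a)" "connected (insert (p a) (T a))" "p b3 \<in> T a" if "a \<in> A" for a
  proof -
    note a = arcs[OF that bmem(3)]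
    show "connected (T a)"
      using connected_arc_image_delete_end[OF a(1)] a unfolding T_def by simp
    have "insert (p a) (T a) = path_image (g b3 a)"
      using a unfolding T_def by auto
    then show "connected (insert (p a) (T a))"
      using a(1) connected_arc_image by metis
    show "p b3 \<in> T a"
      using a ne[OF that bmem(3)] p_eq[of b3 a] that bmem unfolding T_def by auto
  qed
  have on: "p a \<in> path_image (c a) - {p b1, p b2}" if "a \<in> A" for a
    using that bmem arcs(7)[OF that bmem(1)] p_eq[of a b1] p_eq[of a b2] ne unfolding c_img[OF that] by auto
  show False
  proof (rule theta_contradiction)
    show "arc (c a1)" "arc (c a2)" "arc (c a3)" using amem c_arc by auto
    show "pathstart (c a1) = p b1" "pathstart (c a2) = p b1" "pathstart (c a3) = p b1"
      "pathfinish (c a1) = p b2" "pathfinish (c a2) = p b2" "pathfinish (c a3) = p b2"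
      using amem c_ends by auto
    show "path_image (c a1) \<inter> path_image (c a2) = {p b1, p b2}"
      "path_image (c a1) \<inter> path_image (c a3) = {p b1, p b2}"
      "path_image (c a2) \<inter> path_image (c a3) = {p b1, p b2}"
      using amem A by (simp_all add: c_int)
    show "p a1 \<in> path_image (c a1) - {p b1, p b2}" "p a2 \<in> path_image (c a2) - {p b1, p b2}"
      "p a3 \<in> path_image (c a3) - {p b1, p b2}"
      using on amem by blast+
    show "connected (T a1)" "connected (T a2)" "connected (T a3)"
      "connected (insert (p a1) (T a1))" "connected (insert (p a2) (T a2))" "connected (insert (p a3) (T a3))"
      "p b3 \<in> T a1" "p b3 \<in> T a2" "p b3 \<in> T a3"
      using T_conn amem by blast+
    show "(T a1 \<union> T a2 \<union> T a3) \<inter> (path_image (c a1) \<union> path_image (c a2) \<union> path_image (c a3)) = {}"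
      using T_disj amem by (simp add: Int_Un_distrib Int_Un_distrib2)
  qed
qed

section \<open>Degrees and induced subgraphs\<close>

definition nbrs :: "'a set set \<Rightarrow> 'a \<Rightarrow> 'a set" where
  "nbrs E v = {w. {v,w} \<in> E}"

lemma nbrs_sym: "w \<in> nbrs E v \<longleftrightarrow> v \<in> nbrs E w"
  by (simp add: nbrs_def insert_commute)

lemma simple_graph_finite:
  assumes "simple_graph V E"
  shows "finite V" "finite E"
proof -
  show "finite V" using assms by (simp add: simple_graph_def)
  moreover have "E \<subseteq> Pow V" using assms by (auto simp: simple_graph_def)
  ultimately show "finite E" by (simp add: finite_subset)
qed

lemma simple_graph_edgeE:
  assumes "simple_graph V E" "e \<in> E"
  obtains a b where "e = {a,b}" "a \<noteq> b" "a \<in> V" "b \<in> V" "b \<in> nbrs E a"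
proof -
  have "card e = 2" "e \<subseteq> V" using assms by (auto simp: simple_graph_def)
  then obtain a b where "e = {a,b}" "a \<noteq> b" by (auto simp: card_2_iff)
  then show ?thesis using that assms \<open>e \<subseteq> V\<close> by (auto simp: nbrs_def)
qed

lemma nbrs_simple_graph:
  assumes "simple_graph V E"
  shows "v \<notin> nbrs E v" "nbrs E v \<subseteq> V" "finite (nbrs E v)"
proof -
  have "w \<in> V \<and> v \<noteq> w" if "{v,w} \<in> E" for w
  proof -
    have "card {v,w} = 2" "{v,w} \<subseteq> V" using assms that by (auto simp: simple_graph_def)
    then show ?thesis by (auto simp: card_2_iff)
  qed
  then show "v \<notin> nbrs E v" "nbrs E v \<subseteq> V" by (auto simp only: nbrs_def mem_Collect_eq subset_iff)
  then show "finite (nbrs E v)" using assms finite_subset by (auto simp: simple_graph_def)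
qed

lemma card_incident_edges:
  assumes "simple_graph V E"
  shows "card {e \<in> E. v \<in> e} = card (nbrs E v)"
proof -
  have "bij_betw (\<lambda>w. {v,w}) (nbrs E v) {e \<in> E. v \<in> e}"
    unfolding bij_betw_def
  proof
    show "inj_on (\<lambda>w. {v,w}) (nbrs E v)" by (auto simp: inj_on_def doubleton_eq_iff)
    show "(\<lambda>w. {v,w}) ` nbrs E v = {e \<in> E. v \<in> e}"
    proof
      show "(\<lambda>w. {v,w}) ` nbrs E v \<subseteq> {e \<in> E. v \<in> e}" by (auto simp: nbrs_def)
      show "{e \<in> E. v \<in> e} \<subseteq> (\<lambda>w. {v,w}) ` nbrs E v"
      proof
        fix e assume "e \<in> {e \<in> E. v \<in> e}"
        then obtain a b where "e = {a,b}" "e \<in> E" "v \<in> e"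
          using assms simple_graph_edgeE by (metis (no_types, lifting) mem_Collect_eq)
        then show "e \<in> (\<lambda>w. {v,w}) ` nbrs E v"
          by (auto simp: nbrs_def insert_commute)
      qed
    qed
  qed
  then show ?thesis using bij_betw_same_card by metis
qed

lemma handshake:
  assumes "simple_graph V E"
  shows "(\<Sum>v\<in>V. card (nbrs E v)) = 2 * card E"
proof -
  have "card {v \<in> V. v \<in> e} = 2" if "e \<in> E" for e
  proof -
    have "{v \<in> V. v \<in> e} = e" using assms that by (auto simp: simple_graph_def)
    then show ?thesis using assms that by (simp add: simple_graph_def)
  qed
  then have "(\<Sum>v\<in>V. card {e \<in> E. v \<in> e}) = 2 * card E"
    using simple_graph_finite[OF assms] by (intro sum_multicount) auto
  then show ?thesis using card_incident_edges[OF assms] by simp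
qed

lemma simple_graph_induced:
  assumes "simple_graph V E" "V' \<subseteq> V"
  shows "simple_graph V' {e \<in> E. e \<subseteq> V'}"
  using assms finite_subset[OF assms(2)] by (simp add: simple_graph_def)

lemma planar_graph_induced:
  fixes V :: "'a set"
  assumes "planar_graph V E" "V' \<subseteq> V"
  shows "planar_graph V' {e \<in> E. e \<subseteq> V'}"
proof -
  obtain p :: "'a \<Rightarrow> complex" and \<gamma> where p: "inj_on p V"
    "\<forall>e\<in>E. arc (\<gamma> e) \<and> {pathstart (\<gamma> e), pathfinish (\<gamma> e)} = p ` e \<and> path_image (\<gamma> e) \<inter> p ` V = p ` e"
    "\<forall>e\<in>E. \<forall>e'\<in>E. e \<noteq> e' \<longrightarrow> path_image (\<gamma> e) \<inter> path_image (\<gamma> e') \<subseteq> p ` (e \<inter> e')"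
    using assms(1) unfolding planar_graph_def by (elim exE conjE)
  have "path_image (\<gamma> e) \<inter> p ` V' = p ` e" if "e \<in> E" "e \<subseteq> V'" for e
  proof -
    have "p ` V' = p ` V \<inter> p ` V'" "p ` e \<subseteq> p ` V'" using that assms(2) by blast+
    moreover have "path_image (\<gamma> e) \<inter> p ` V = p ` e" using p(2) that(1) by blast
    ultimately show ?thesis by (metis Int_assoc Int_absorb2)
  qed
  then show ?thesis
    unfolding planar_graph_def using p inj_on_subset[OF p(1) assms(2)]
    by (intro exI[of _ p] exI[of _ \<gamma>]) simp
qed

lemma contains_subgraph_mono:
  assumes "contains_subgraph V' E' VF EF" "V' \<subseteq> V" "E' \<subseteq> E"
  shows "contains_subgraph V E VF EF"
  using assms unfolding contains_subgraph_def by blast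

section \<open>Double stars and the upper bound\<close>

lemma contains_dstarI:
  assumes G: "simple_graph V E" and xy: "{x,y} \<in> E"
    and A: "A \<subseteq> nbrs E x - {y}" "card A = m" and B: "B \<subseteq> nbrs E y - {x}" "card B = k"
    and disj: "A \<inter> B = {}"
  shows "contains_subgraph V E (dstar_V m k) (dstar_E m k)"
proof -
  have fin: "finite A" "finite B"
    using A B nbrs_simple_graph(3)[OF G] finite_subset by blast+
  obtain f where f: "bij_betw f {2..m+1} A"
    using fin A finite_same_card_bij[of "{2..m+1}" A] by auto
  obtain g where g: "bij_betw g {m+2..m+k+1} B"
    using fin B finite_same_card_bij[of "{m+2..m+k+1}" B] by auto
  \<comment> \<open>This follows the numbering in \<open>dstar_E\<close>: 0 and 1 are the backbone,
    the next \<open>m\<close> labels are leaves at 0, the last \<open>k\<close> are leaves at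
    1.\<close>
  define h where "h i = (if i = 0 then x else if i = 1 then y else if i \<le> m+1 then f i else g i)" for i
  have fA: "f i \<in> A" if "2 \<le> i" "i \<le> m+1" for i
    using that f by (auto simp: bij_betw_def)
  have gB: "g i \<in> B" if "m+2 \<le> i" "i \<le> m+k+1" for i
    using that g by (auto simp: bij_betw_def)
  have xy': "x \<noteq> y" "x \<in> V" "y \<in> V"
    using G xy by (auto simp: simple_graph_def dest: bspec[where x = "{x,y}"])
  have notin: "x \<notin> A" "y \<notin> A" "x \<notin> B" "y \<notin> B"
    using A B nbrs_simple_graph(1)[OF G] by blast+
  have AV: "A \<subseteq> V" "B \<subseteq> V" using A B nbrs_simple_graph(2)[OF G] by blast+
  have V_eq: "dstar_V m k = {0,1} \<union> {2..m+1} \<union> {m+2..m+k+1}"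
    by (auto simp: dstar_V_def)
  have hf: "h i = f i" if "i \<in> {2..m+1}" for i using that by (simp add: h_def)
  have hg: "h i = g i" if "i \<in> {m+2..m+k+1}" for i using that by (simp add: h_def)
  have h01: "bij_betw h {0,1} {x,y}"
    using xy' by (auto simp: bij_betw_def h_def)
  have hAB: "bij_betw h ({2..m+1} \<union> {m+2..m+k+1}) (A \<union> B)"
  proof (rule bij_betw_combine[OF _ _ disj])
    show "bij_betw h {2..m+1} A" using f bij_betw_cong[of _ h f, OF hf] by blast
    show "bij_betw h {m+2..m+k+1} B" using g bij_betw_cong[of _ h g, OF hg] by blast
  qed
  have bij: "bij_betw h (dstar_V m k) ({x,y} \<union> (A \<union> B))"
    unfolding V_eq Un_assoc by (rule bij_betw_combine[OF h01 hAB]) (use notin in blast)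
  then have "inj_on h (dstar_V m k)"
    by (rule bij_betw_imp_inj_on)
  moreover have "h ` dstar_V m k \<subseteq> V"
    using bij_betw_imp_surj_on[OF bij] xy' AV by simp
  moreover have "h ` e \<in> E" if e: "e \<in> dstar_E m k" for e
  proof -
    have xf: "{x, f i} \<in> E" if "2 \<le> i" "i \<le> m+1" for i
      using fA[OF that] A by (auto simp: nbrs_def)
    have yg: "{y, g i} \<in> E" if "m+2 \<le> i" "i \<le> m+k+1" for i
      using gB[OF that] B by (auto simp: nbrs_def)
    consider "e = {0,1}" | i where "e = {0,i}" "2 \<le> i" "i \<le> m+1"
      | i where "e = {1,i}" "m+2 \<le> i" "i \<le> m+k+1"
      using e unfolding dstar_E_def by blast
    then show ?thesis
      using xy xf yg by cases (simp_all add: h_def insert_commute)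
  qed
  ultimately show ?thesis unfolding contains_subgraph_def by blast
qed

text \<open>With backbone \<open>xy\<close>, two leaves are taken at \<open>x\<close> and three must
  remain at \<open>y\<close>. This works whenever \<open>y\<close> has enough spare neighbours, or
  when a leaf of \<open>x\<close> costs \<open>y\<close> nothing because it is not adjacent to
  \<open>y\<close>.\<close>

lemma dstar_free_nbrs_subset:
  assumes G: "simple_graph V E" and free: "\<not> contains_subgraph V E (dstar_V 2 3) (dstar_E 2 3)"
    and y: "card (nbrs E y) \<ge> 5" and x: "x \<in> nbrs E y" "card (nbrs E x) \<ge> 3"
  shows "card (nbrs E y) = 5" "nbrs E x \<subseteq> insert y (nbrs E y)"
proof -
  note fin = nbrs_simple_graph(3)[OF G]
  have xy: "{x,y} \<in> E" "y \<in> nbrs E x" using x(1) by (auto simp: nbrs_def insert_commute)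
  have star: False if A: "A \<subseteq> nbrs E x - {y}" "card A = 2" "card (nbrs E y - {x} - A) \<ge> 3" for A
  proof -
    obtain B where "B \<subseteq> nbrs E y - {x} - A" "card B = 3"
      using obtain_subset_with_card_n[OF A(3)] by blast
    then show False using contains_dstarI[OF G xy(1) A(1,2), of B 3] free by blast
  qed
  have cx: "card (nbrs E x - {y}) \<ge> 2" and cy: "card (nbrs E y - {x}) = card (nbrs E y) - 1"
    using x xy fin by simp_all
  show "card (nbrs E y) = 5"
  proof (rule ccontr)
    assume "card (nbrs E y) \<noteq> 5"
    obtain A where A: "A \<subseteq> nbrs E x - {y}" "card A = 2"
      using obtain_subset_with_card_n[OF cx] by blast
    \<comment> \<open>A degree of at least 6 leaves five neighbours besides \<open>x\<close>, and
      three after losing \<open>A\<close>.\<close>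
    have "card (nbrs E y - {x} - A) \<ge> card (nbrs E y - {x}) - card A"
      using A fin by (intro diff_card_le_card_Diff) (meson finite_Diff finite_subset)
    then have "card (nbrs E y - {x} - A) \<ge> 3"
      using A cy y \<open>card (nbrs E y) \<noteq> 5\<close> by linarith
    then show False by (rule star[OF A])
  qed
  show "nbrs E x \<subseteq> insert y (nbrs E y)"
  proof (rule ccontr)
    assume "\<not> ?thesis"
    \<comment> \<open>The leaf \<open>w\<close> takes no neighbour from \<open>y\<close>, so only
      the second leaf \<open>w'\<close> can, and at least 4 - 1 = 3 remain.\<close>
    then obtain w where w: "w \<in> nbrs E x" "w \<noteq> y" "w \<notin> nbrs E y" by blast
    have "card (nbrs E x - {y} - {w}) = card (nbrs E x - {y}) - 1"
      using w by (intro card_Diff_singleton) auto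
    with cx have "card (nbrs E x - {y} - {w}) \<noteq> 0" by linarith
    then have "nbrs E x - {y} - {w} \<noteq> {}" by (metis card.empty)
    then obtain w' where w': "w' \<in> nbrs E x - {y}" "w' \<noteq> w" by blast
    have "nbrs E y - {x} - {w,w'} = nbrs E y - {x} - {w'}" using w by blast
    moreover have "card (nbrs E y - {x} - {w'}) \<ge> card (nbrs E y - {x}) - 1"
      using diff_card_le_card_Diff[of "{w'}" "nbrs E y - {x}"] by simp
    ultimately have "card (nbrs E y - {x} - {w,w'}) \<ge> 3" using cy y by simp
    then show False using star[of "{w,w'}"] w w' by auto
  qed
qed

text \<open>This is the planar bound 3 * 6 - 6, obtained without Euler's formula. With 13 or more of
  the 15 possible edges at most two pairs are missing, and the vertices can be halved so that no
  missing pair crosses between the halves.\<close>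

lemma planar_card_edges_le_12:
  assumes G: "simple_graph V E" and planar: "planar_graph V E" and V: "card V = 6"
  shows "card E \<le> 12"
proof (rule ccontr)
  assume "\<not> card E \<le> 12"
  let ?K = "{e. e \<subseteq> V \<and> card e = 2}"
  have finV: "finite V" using G simple_graph_finite by blast
  have "card ?K = 6 choose 2" using n_subsets[OF finV, of 2] V by simp
  then have cardK: "card ?K = 15" by (simp add: choose_two)
  have "E \<subseteq> ?K" using G by (auto simp: simple_graph_def)
  then have "card (?K - E) \<le> 2"
    using cardK \<open>\<not> card E \<le> 12\<close> card_Diff_subset[of E ?K] simple_graph_finite[OF G] by simp
  then obtain M where M: "?K - E \<subseteq> M" "M \<subseteq> ?K" "card M = 2"
    using exists_subset_between[of "?K - E" 2 ?K] cardK finV by auto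
  then obtain e1 e2 where e: "M = {e1,e2}" "e1 \<noteq> e2" by (auto simp: card_2_iff)
  have c: "e1 \<subseteq> V" "e2 \<subseteq> V" "card e1 = 2" "card e2 = 2" using M e by auto
  then have fin: "finite e1" "finite e2" using finV finite_subset by blast+
  \<comment> \<open>Pad the missing pairs to exactly two; three vertices forming a set that splits neither pair are one side of a \<open>K\<^sub>3\<^sub>,\<^sub>3\<close>.\<close>
  obtain x where x: "x \<in> V - e1" "e2 \<subseteq> insert x e1 \<or> e2 \<inter> insert x e1 = {}"
  proof (cases "e1 \<inter> e2 = {}")
    case True
    \<comment> \<open>Two disjoint pairs cover four of the six vertices; any other vertex completes
      \<open>e1\<close> to a side, with \<open>e2\<close> on the opposite side.\<close>
    have "card (e1 \<union> e2) = 4" using True c fin by (simp add: card_Un_disjoint)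
    then have "\<not> V \<subseteq> e1 \<union> e2" using V fin card_mono[of "e1 \<union> e2" V] by auto
    then show ?thesis using that True by blast
  next
    case False
    \<comment> \<open>Distinct pairs sharing a vertex span exactly three vertices, and these form
      the side.\<close>
    then obtain w where w: "w \<in> e1" "w \<in> e2" by blast
    have "\<not> e2 \<subseteq> e1" using c fin e(2) card_subset_eq by metis
    then obtain x where x: "x \<in> e2" "x \<notin> e1" by blast
    then have "w \<noteq> x" using w by blast
    then have "{w,x} \<subseteq> e2" "card {w,x} = 2" using w x by auto
    then have "e2 = {w,x}" using c fin card_subset_eq by metis
    then show ?thesis using that[of x] w x c by auto
  qed
  let ?A = "insert x e1"
  have "card ?A = 3" "?A \<subseteq> V" using x c fin by auto
  moreover have "card (V - ?A) = 3"
    using \<open>card ?A = 3\<close> \<open>?A \<subseteq> V\<close> V fin card_Diff_subset[of ?A V] by simp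
  moreover have "{a,b} \<in> E" if ab: "a \<in> ?A" "b \<in> V - ?A" for a b
  proof -
    have "a \<noteq> b" using ab by blast
    then have "{a,b} \<in> ?K" using ab \<open>?A \<subseteq> V\<close> by auto
    moreover have "{a,b} \<noteq> e1" "{a,b} \<noteq> e2" using ab x(2) by auto
    ultimately show ?thesis using M(1) e(1) by blast
  qed
  ultimately show False
    by (intro not_planar_K33[OF planar, of ?A "V - ?A"]) auto
qed

theorem dstar_2_3_free_planar_card_edges:
  assumes "simple_graph V E" "planar_graph V E"
    "\<not> contains_subgraph V E (dstar_V 2 3) (dstar_E 2 3)"
  shows "card E \<le> 2 * card V"
  using assms
proof (induction "card V" arbitrary: V E rule: less_induct)
  case less
  note G = less.prems(1)
  note fin = simple_graph_finite[OF G]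
  \<comment> \<open>All three hypotheses pass to induced subgraphs, so the induction applies to
    every proper subset of the vertices.\<close>
  have IH: "card {e \<in> E. e \<subseteq> V'} \<le> 2 * card V'" if "V' \<subset> V" for V'
  proof (rule less.hyps)
    show "card V' < card V" using that fin psubset_card_mono by blast
    show "simple_graph V' {e \<in> E. e \<subseteq> V'}" using simple_graph_induced[OF G] that by blast
    show "planar_graph V' {e \<in> E. e \<subseteq> V'}" using planar_graph_induced[OF less.prems(2)] that by blast
    show "\<not> contains_subgraph V' {e \<in> E. e \<subseteq> V'} (dstar_V 2 3) (dstar_E 2 3)"
      using less.prems(3) contains_subgraph_mono[of V' "{e \<in> E. e \<subseteq> V'}" _ _ V E] that by blast
  qed
  \<comment> \<open>A vertex of degree at least 5 is treated only when no degree is below 3, so that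
    each of its neighbours meets the degree condition of
    \<open>dstar_free_nbrs_subset\<close>.\<close>
  consider (low) v where "v \<in> V" "card (nbrs E v) \<le> 2"
    | (high) y where "y \<in> V" "card (nbrs E y) \<ge> 5" "\<forall>v\<in>V. card (nbrs E v) \<ge> 3"
    | (mid) "\<forall>v\<in>V. card (nbrs E v) \<le> 4"
  proof -
    have "d \<le> 2 \<or> 3 \<le> d" "d \<le> 4 \<or> 5 \<le> d" for d :: nat by linarith+
    then show thesis using low high mid by blast
  qed
  then show ?case
  proof cases
    case low
    \<comment> \<open>Deleting \<open>v\<close> costs at most two edges and lowers the bound by
      exactly two.\<close>
    have "E = {e \<in> E. e \<subseteq> V - {v}} \<union> {e \<in> E. v \<in> e}"
      using G by (auto simp: simple_graph_def)
    then have "card E \<le> card {e \<in> E. e \<subseteq> V - {v}} + card {e \<in> E. v \<in> e}"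
      using card_Un_le by metis
    also have "\<dots> \<le> 2 * card (V - {v}) + 2"
      using IH[of "V - {v}"] low card_incident_edges[OF G, of v] by fastforce
    also have "\<dots> = 2 * card V"
      using low(1) fin card_Suc_Diff1[of V v] by simp
    finally show ?thesis .
  next
    case high
    let ?C = "insert y (nbrs E y)"
    have big: "card (nbrs E x) \<ge> 3" if "x \<in> nbrs E y" for x
      using that high(3) nbrs_simple_graph(2)[OF G] by blast
    have nb: "nbrs E x \<subseteq> ?C" if "x \<in> ?C" for x
      using that dstar_free_nbrs_subset(2)[OF G less.prems(3) high(2) _ big] by blast
    \<comment> \<open>A neighbour of \<open>y\<close> is needed in order to conclude that the degree
      of \<open>y\<close> is exactly 5.\<close>
    have "nbrs E y \<noteq> {}" using high(2) by auto
    then have "card (nbrs E y) = 5"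
      using dstar_free_nbrs_subset(1)[OF G less.prems(3) high(2) _ big] by blast
    then have C: "card ?C = 6" "?C \<subseteq> V"
      using nbrs_simple_graph[OF G] high(1) by auto
    have "e \<subseteq> ?C \<or> e \<subseteq> V - ?C" if "e \<in> E" for e
    proof -
      obtain a b where "e = {a,b}" "a \<in> V" "b \<in> V" "b \<in> nbrs E a"
        using simple_graph_edgeE[OF G \<open>e \<in> E\<close>] by metis
      then show ?thesis using nb nbrs_sym[of b E a] by blast
    qed
    then have "E = {e \<in> E. e \<subseteq> ?C} \<union> {e \<in> E. e \<subseteq> V - ?C}" by blast
    then have "card E \<le> card {e \<in> E. e \<subseteq> ?C} + card {e \<in> E. e \<subseteq> V - ?C}"
      using card_Un_le by metis
    \<comment> \<open>The closed neighbourhood is a union of components with six vertices, and 12 =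
      2 * 6 is just its share of the bound.\<close>
    also have "\<dots> \<le> 12 + 2 * card (V - ?C)"
      using planar_card_edges_le_12[OF simple_graph_induced[OF G C(2)]
          planar_graph_induced[OF less.prems(2) C(2)] C(1)] IH[of "V - ?C"] high(1)
      by (intro add_mono) auto
    also have "\<dots> = 2 * card V"
      using C fin card_Diff_subset[of ?C V] card_mono[of V ?C] finite_subset[of ?C V] by simp
    finally show ?thesis .
  next
    case mid
    have "2 * card E = (\<Sum>v\<in>V. card (nbrs E v))" using handshake[OF G] by simp
    also have "\<dots> \<le> (\<Sum>v\<in>V. 4)" using mid by (intro sum_mono) auto
    finally show ?thesis by simp
  qed
qed

section \<open>A straight-line drawing of K_{2,n-2} and the lower bound\<close>

definition K2n_edges :: "nat \<Rightarrow> nat set set" where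
  "K2n_edges n = {{s,i} | s i. s < 2 \<and> 2 \<le> i \<and> i < n}"

lemma K2n_edges_iff:
  "{a,b} \<in> K2n_edges n \<longleftrightarrow> a < 2 \<and> 2 \<le> b \<and> b < n \<or> b < 2 \<and> 2 \<le> a \<and> a < n"
  unfolding K2n_edges_def mem_Collect_eq doubleton_eq_iff by blast

text \<open>The two ends of an edge come from disjoint ranges, so unordered pairs are counted like
  ordered ones. Truncated subtraction is also right for \<open>n < 2\<close>, where there are no
  edges.\<close>

lemma card_K2n_edges: "card (K2n_edges n) = 2 * (n - 2)"
proof -
  have "K2n_edges n = (\<lambda>(s,i). {s,i}) ` ({..<2} \<times> {2..<n})"
    unfolding K2n_edges_def by (auto, blast)
  moreover have "inj_on (\<lambda>(s,i). {s,i}) ({..<2} \<times> {2..<n})"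
    by (auto simp: inj_on_def doubleton_eq_iff)
  ultimately show ?thesis by (simp add: card_image)
qed

lemma simple_graph_K2n: "simple_graph {..<n} (K2n_edges n)"
  by (auto simp: simple_graph_def K2n_edges_def)

text \<open>In a bipartite graph each backbone vertex lies on the same side as the leaves of the
  other one. The backbone end that is not a centre thus has three distinct neighbours among the two
  centres.\<close>

lemma K2n_dstar_free: "\<not> contains_subgraph {..<n} (K2n_edges n) (dstar_V 2 3) (dstar_E 2 3)"
proof
  assume "contains_subgraph {..<n} (K2n_edges n) (dstar_V 2 3) (dstar_E 2 3)"
  then obtain \<phi> where inj: "inj_on \<phi> (dstar_V 2 3)"
    and edges: "\<And>e. e \<in> dstar_E 2 3 \<Longrightarrow> \<phi> ` e \<in> K2n_edges n"
    unfolding contains_subgraph_def by blast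
  have "{0,1} \<in> dstar_E 2 3" "{0,2} \<in> dstar_E 2 3" "{0,3} \<in> dstar_E 2 3"
    "{1,4} \<in> dstar_E 2 3" "{1,5} \<in> dstar_E 2 3"
    by (auto simp: dstar_E_def)
  from this[THEN edges]
  have e: "{\<phi> 0, \<phi> 1} \<in> K2n_edges n" "{\<phi> 0, \<phi> 2} \<in> K2n_edges n" "{\<phi> 0, \<phi> 3} \<in> K2n_edges n"
    "{\<phi> 1, \<phi> 4} \<in> K2n_edges n" "{\<phi> 1, \<phi> 5} \<in> K2n_edges n"
    by simp_all
  have ne: "\<phi> i \<noteq> \<phi> j" if "i < 7" "j < 7" "i \<noteq> j" for i j
    using inj that by (simp add: inj_on_eq_iff dstar_V_def)
  show False
  proof (cases "\<phi> 0 < 2")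
    case True
    then have "\<phi> 4 < 2" "\<phi> 5 < 2"
      using e(1,4,5) unfolding K2n_edges_iff by linarith+
    then show False using True ne[of 0 4] ne[of 0 5] ne[of 4 5] by linarith
  next
    case False
    then have "\<phi> 1 < 2" "\<phi> 2 < 2" "\<phi> 3 < 2"
      using e(1-3) unfolding K2n_edges_iff by linarith+
    then show False using ne[of 1 2] ne[of 1 3] ne[of 2 3] by linarith
  qed
qed

text \<open>With ends on the two axes, incidences can be read off the real and imaginary parts
  separately.\<close>

lemma mem_axis_segment_iff:
  "w \<in> closed_segment (Complex s 0) (Complex 0 t) \<longleftrightarrow>
     (\<exists>u. 0 \<le> u \<and> u \<le> 1 \<and> Re w = (1 - u) * s \<and> Im w = u * t)"
  by (auto simp: closed_segment_def complex_eq_iff)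

lemma planar_graph_K2n: "planar_graph {..<n} (K2n_edges n)"
proof -
  \<comment> \<open>The centres 0 and 1 are placed at 1 and -1, and every other vertex
    \<open>i\<close> at height \<open>i\<close> on the imaginary axis.\<close>
  define sg :: "nat \<Rightarrow> real" where "sg s = 1 - 2 * real s" for s
  have sg: "sg s \<noteq> 0" "s' < 2 \<Longrightarrow> s \<noteq> s' \<Longrightarrow> sg s' = - sg s" if "s < 2" for s s'
    using that by (auto simp: sg_def less_2_cases_iff)
  define p where "p i = (if i < 2 then Complex (sg i) 0 else Complex 0 (real i))" for i
  \<comment> \<open>Centres have the smaller labels, so \<open>Min\<close> and \<open>Max\<close>
    recover the two ends of an edge in a fixed order.\<close>
  define \<gamma> where "\<gamma> e = linepath (p (Min e)) (p (Max e))" for e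
  have p_lo: "p s = Complex (sg s) 0" if "s < 2" for s using that by (simp add: p_def)
  have p_hi: "p i = Complex 0 (real i)" if "2 \<le> i" for i using that by (simp add: p_def)
  have \<gamma>: "\<gamma> {s,i} = linepath (p s) (p i)" if "s < 2" "2 \<le> i" for s i
  proof -
    have "Min {s,i} = s" "Max {s,i} = i" using that by (simp_all add: min_def max_def)
    then show ?thesis unfolding \<gamma>_def by simp
  qed
  have inj: "inj p"
  proof (rule injI)
    fix i j assume eq: "p i = p j"
    consider "i < 2" "j < 2" | "i < 2" "2 \<le> j" | "2 \<le> i" "j < 2" | "2 \<le> i" "2 \<le> j" by linarith
    then show "i = j"
      using eq by cases (simp_all add: p_lo p_hi sg_def)
  qed
  have img: "w \<in> path_image (\<gamma> {s,i}) \<longleftrightarrow>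
      (\<exists>u. 0 \<le> u \<and> u \<le> 1 \<and> Re w = (1 - u) * sg s \<and> Im w = u * real i)"
    if "s < 2" "2 \<le> i" for s i w
    unfolding \<gamma>[OF that] p_lo[OF that(1)] p_hi[OF that(2)] path_image_linepath
    by (rule mem_axis_segment_iff)
  have vertex: "k = s \<or> k = i" if si: "s < 2" "2 \<le> i" and k: "p k \<in> path_image (\<gamma> {s,i})" for s i k
  proof -
    obtain u where u: "0 \<le> u" "u \<le> 1" "Re (p k) = (1 - u) * sg s" "Im (p k) = u * real i"
      using k unfolding img[OF si] by blast
    show ?thesis
    proof (cases "k < 2")
      case True
      then have "u = 0" using u(4) si(2) by (simp add: p_lo)
      then show ?thesis using u(3) True by (simp add: p_lo sg_def)
    next
      case False
      then have "u = 1" using u(3) sg(1)[OF si(1)] by (simp add: p_hi)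
      then show ?thesis using False u(4) by (simp add: p_hi)
    qed
  qed
  \<comment> \<open>For a common centre the real parts give equal parameters, and different heights
    then force the point to be that centre. For opposite centres the real parts have opposite signs,
    so both vanish and the point is a common end on the imaginary axis.\<close>
  have cross: "w \<in> p ` ({s,i} \<inter> {s',i'})"
    if s: "s < 2" "2 \<le> i" "s' < 2" "2 \<le> i'" and ne: "{s,i} \<noteq> {s',i'}"
      and w: "w \<in> path_image (\<gamma> {s,i})" "w \<in> path_image (\<gamma> {s',i'})" for s i s' i' w
  proof -
    obtain u where u: "0 \<le> u" "u \<le> 1" "Re w = (1 - u) * sg s" "Im w = u * real i"
      using w unfolding img[OF s(1,2)] by blast
    obtain u' where u': "0 \<le> u'" "u' \<le> 1" "Re w = (1 - u') * sg s'" "Im w = u' * real i'"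
      using w unfolding img[OF s(3,4)] by blast
    show ?thesis
    proof (cases "s = s'")
      case True
      then have "u = u'" using u(3) u'(3) sg(1)[OF s(1)] by simp
      moreover have "i \<noteq> i'" using True ne by blast
      ultimately have "u = 0" using u(4) u'(4) by simp
      then have "w = p s" using u s by (simp add: p_lo complex_eq_iff)
      then show ?thesis using True by blast
    next
      case False
      then have "(1 - u) * sg s = (1 - u') * (- sg s)"
        using u(3) u'(3) sg(2)[OF s(1,3)] by metis
      then have "(1 - u) * sg s = - (1 - u') * sg s" by algebra
      then have "1 - u = - (1 - u')"
        using sg(1)[OF s(1)] by (metis mult_right_cancel)
      then have "u = 1" "u' = 1" using u(2) u'(2) by linarith+
      then have "Re w = 0" "Im w = real i" "Im w = real i'" using u u' by simp_all
      then have "w = p i" "i = i'" using s by (simp_all add: p_hi complex_eq_iff)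
      then show ?thesis by blast
    qed
  qed
  show ?thesis
    unfolding planar_graph_def
  proof (intro exI[of _ p] exI[of _ \<gamma>] conjI ballI impI)
    show "inj_on p {..<n}" using inj inj_on_subset by blast
  next
    fix e assume "e \<in> K2n_edges n"
    then obtain s i where e: "e = {s,i}" "s < 2" "2 \<le> i" "i < n"
      unfolding K2n_edges_def by blast
    have "p s \<noteq> p i" using e inj by (simp add: inj_eq)
    then show "arc (\<gamma> e)" "{pathstart (\<gamma> e), pathfinish (\<gamma> e)} = p ` e"
      using e \<gamma> by auto
    have "p s \<in> path_image (\<gamma> e)" "p i \<in> path_image (\<gamma> e)"
      using e \<gamma> by auto
    then show "path_image (\<gamma> e) \<inter> p ` {..<n} = p ` e"
      using e vertex by auto
  next
    fix e e' assume "e \<in> K2n_edges n" "e' \<in> K2n_edges n" "e \<noteq> e'"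
    then show "path_image (\<gamma> e) \<inter> path_image (\<gamma> e') \<subseteq> p ` (e \<inter> e')"
      unfolding K2n_edges_def using cross by blast
  qed
qed

theorem theorem1p1:
  fixes n :: nat
  assumes "n \<ge> 1"
  shows "2 * int n - 4 \<le> int (exP n (dstar_V 2 3) (dstar_E 2 3))
       \<and> exP n (dstar_V 2 3) (dstar_E 2 3) \<le> 2 * n"
proof -
  let ?S = "{card E | (V :: nat set) E. card V = n \<and> simple_graph V E \<and> planar_graph V E \<and>
      \<not> contains_subgraph V E (dstar_V 2 3) (dstar_E 2 3)}"
  \<comment> \<open>The upper bound also makes the set finite, and the K_{2,n-2} example makes it
    nonempty, so \<open>Max\<close> is meaningful.\<close>
  have le: "c \<le> 2 * n" if "c \<in> ?S" for c
    using that dstar_2_3_free_planar_card_edges by blast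
  then have "finite ?S" by (meson finite_nat_set_iff_bounded_le)
  \<comment> \<open>For \<open>n = 1\<close> the truncated value is 0, which still exceeds the
    integer -2 of the claim.\<close>
  have mem: "2 * (n - 2) \<in> ?S"
    using assms card_K2n_edges[of n] simple_graph_K2n planar_graph_K2n K2n_dstar_free card_lessThan[of n]
    by (metis (mono_tags, lifting) mem_Collect_eq)
  have "2 * (n - 2) \<le> Max ?S"
    using \<open>finite ?S\<close> mem by (rule Max_ge)
  moreover have "Max ?S \<le> 2 * n"
    using \<open>finite ?S\<close> mem le by (intro Max.boundedI) blast+
  ultimately show ?thesis unfolding exP_def by linarith
qed

end
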